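(* Let $\alpha_1, A_1, \alpha_2 > 0$ and consider the system of difference equations $$x_{n+1}=\frac{\alpha_{1}}{A_{1}+y_{n}},\qquad y_{n+1}=\alpha_{2}+x_{n},\qquad n=0,1,2,\dots,$$ with arbitrary nonnegative initial conditions $x_0,y_0$. There is a unique nonnegative equilibrium, namely $$\left(\frac{-\alpha_{2}-A_{1}+\sqrt{\left(\alpha_{2}+A_{1}\right)^{2}+4\alpha_{1}}}{2},\frac{\alpha_{2}-A_{1}+\sqrt{\left(\alpha_{2}+A_{1}\right)^{2}+4\alpha_{1}}}{2}\right),$$ and it is globally asymptotically stable.
   Context: The state space is $[0,\infty)^2$. A nonnegative equilibrium is a point $(\bar x,\bar y)\in[0,\infty)^2$ such that the constant sequence $(x_n,y_n)=(\bar x,\bar y)$ solves the system. It is globally asymptotically stable if it is Lyapunov stable relative to $[0,\infty)^2$ (for every $\varepsilon>0$ there is $\delta>0$ such that every initial condition in $[0,\infty)^2$ within $\delta$ of $(\bar x,\bar y)$ has its whole orbit within $\varepsilon$ of $(\bar x,\bar y)$) and every solution with initial condition in $[0,\infty)^2$ converges to $(\bar x,\bar y)$. *)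

theory Defs
  imports "HOL-Analysis.Analysis"
begin

definition state_space :: "(real \<times> real) set" where
  "state_space = {0..} \<times> {0..}"

definition step_map :: "real \<Rightarrow> real \<Rightarrow> real \<Rightarrow> real \<times> real \<Rightarrow> real \<times> real" where
  "step_map \<alpha>\<^sub>1 A\<^sub>1 \<alpha>\<^sub>2 = (\<lambda>(x, y). (\<alpha>\<^sub>1 / (A\<^sub>1 + y), \<alpha>\<^sub>2 + x))"

definition solution :: "(real \<times> real \<Rightarrow> real \<times> real) \<Rightarrow> (nat \<Rightarrow> real \<times> real) \<Rightarrow> bool" where
  "solution F z \<longleftrightarrow> z 0 \<in> state_space \<and> (\<forall>n. z (Suc n) = F (z n))"

definition nonneg_equilibrium :: "(real \<times> real \<Rightarrow> real \<times> real) \<Rightarrow> real \<times> real \<Rightarrow> bool" where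
  "nonneg_equilibrium F p \<longleftrightarrow> p \<in> state_space \<and> solution F (\<lambda>n. p)"

text \<open>Distances are Euclidean: this is the library's metric on products.\<close>

definition lyapunov_stable :: "(real \<times> real \<Rightarrow> real \<times> real) \<Rightarrow> real \<times> real \<Rightarrow> bool" where
  "lyapunov_stable F p \<longleftrightarrow>
     (\<forall>\<epsilon>>0. \<exists>\<delta>>0. \<forall>z. solution F z \<and> dist (z 0) p < \<delta> \<longrightarrow> (\<forall>n. dist (z n) p < \<epsilon>))"

definition globally_asymptotically_stable ::
    "(real \<times> real \<Rightarrow> real \<times> real) \<Rightarrow> real \<times> real \<Rightarrow> bool" where
  "globally_asymptotically_stable F p \<longleftrightarrow>
     lyapunov_stable F p \<and> (\<forall>z. solution F z \<longrightarrow> z \<longlonglongrightarrow> p)"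

end

theory Submission
  imports Defs
begin

text \<open>
  Let \<open>(u, v)\<close> be the equilibrium, so that \<open>u (A + v) = \<alpha>\<^sub>1\<close> and \<open>v = \<alpha>\<^sub>2 + u\<close>. The errors
  \<open>e\<^sub>n = \<bar>x\<^sub>n - u\<bar>\<close> and \<open>d\<^sub>n = \<bar>y\<^sub>n - v\<bar>\<close> satisfy \<open>e\<^sub>n\<^sub>+\<^sub>1 = u d\<^sub>n / (A + y\<^sub>n)\<close> and \<open>d\<^sub>n\<^sub>+\<^sub>1 = e\<^sub>n\<close>.
  One or two steps need not contract, but four do: every error is multiplied by
  \<open>u\<^sup>2 / ((A + y\<^sub>n) (A + y\<^sub>n\<^sub>+\<^sub>2))\<close> for a suitable \<open>n\<close>, where
  \<open>(A + y\<^sub>n) (A + y\<^sub>n\<^sub>+\<^sub>2) = (A + \<alpha>\<^sub>2) (A + y\<^sub>n) + \<alpha>\<^sub>1 \<ge> \<alpha>\<^sub>1 > u\<^sup>2\<close>.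
\<close>

text \<open>Write \<open>n = m * k + j\<close> with \<open>j < k\<close>. The \<open>m\<close> full
  blocks contribute \<open>c ^ m\<close>; the \<open>j\<close> leftover steps may expand, but only
  by \<open>L ^ j\<close>, which is at most \<open>L ^ k\<close> since
  \<open>1 \<le> L\<close>.\<close>

lemma eventual_contraction_bound:
  fixes a :: "nat \<Rightarrow> real"
  assumes step: "\<And>n. a (Suc n) \<le> L * a n"
    and contr: "\<And>n. a (n + k) \<le> c * a n"
    and "1 \<le> L" "0 \<le> c" "0 < k" "0 \<le> a 0"
  shows "a n \<le> c ^ (n div k) * (L ^ k * a 0)"
proof -
  have pow: "a j \<le> L ^ j * a 0" for j
  proof (induction j)
    case (Suc j)
    have "a (Suc j) \<le> L * a j" by (rule step)
    also have "\<dots> \<le> L * (L ^ j * a 0)"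
      using Suc \<open>1 \<le> L\<close> by (intro mult_left_mono) auto
    finally show ?case by (simp add: mult.assoc)
  qed simp
  have blocks: "a (m * k + j) \<le> c ^ m * a j" for m j
  proof (induction m)
    case (Suc m)
    have "a (Suc m * k + j) = a (m * k + j + k)" by (simp add: algebra_simps)
    also have "\<dots> \<le> c * a (m * k + j)" by (rule contr)
    also have "\<dots> \<le> c * (c ^ m * a j)" using Suc \<open>0 \<le> c\<close> by (rule mult_left_mono)
    finally show ?case by (simp add: mult.assoc)
  qed simp
  have "a n \<le> c ^ (n div k) * a (n mod k)"
    using blocks[of "n div k" "n mod k"] by simp
  also have "a (n mod k) \<le> L ^ (n mod k) * a 0" by (rule pow)
  also have "L ^ (n mod k) * a 0 \<le> L ^ k * a 0"
    using assms by (intro mult_right_mono power_increasing) auto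
  finally show ?thesis using \<open>0 \<le> c\<close> by (simp add: mult_left_mono)
qed

lemma power_div_tendsto_zero:
  fixes c :: real
  assumes "0 \<le> c" "c < 1" "0 < k"
  shows "(\<lambda>n. c ^ (n div k)) \<longlonglongrightarrow> 0"
proof -
  have "filterlim (\<lambda>n::nat. n div k) at_top sequentially"
    unfolding filterlim_at_top eventually_sequentially
  proof (intro allI)
    fix m
    show "\<exists>N. \<forall>n\<ge>N. m \<le> n div k"
      using \<open>0 < k\<close> by (intro exI[of _ "m * k"]) (auto simp: less_eq_div_iff_mult_less_eq)
  qed
  with LIMSEQ_power_zero[of c] assms show ?thesis
    by (auto intro: filterlim_compose)
qed

text \<open>One rate \<open>r\<close> serves all solutions. Being convergent it is bounded by some
  \<open>B\<close>, so \<open>\<epsilon> / B\<close> works as the stability radius; its limit 0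
  gives attraction.\<close>

lemma globally_asymptotically_stable_if_uniform_decay:
  assumes bound: "\<And>z n. solution F z \<Longrightarrow> dist (z n) p \<le> r n * dist (z 0) p"
    and lim: "r \<longlonglongrightarrow> 0"
  shows "globally_asymptotically_stable F p"
proof -
  obtain B where "0 < B" and B: "\<And>n. norm (r n) \<le> B"
    using convergent_imp_Bseq[OF convergentI[OF lim]] by (auto elim: BseqE)
  have "\<exists>\<delta>>0. \<forall>z. solution F z \<and> dist (z 0) p < \<delta> \<longrightarrow> (\<forall>n. dist (z n) p < \<epsilon>)"
    if "0 < \<epsilon>" for \<epsilon>
  proof (intro exI[of _ "\<epsilon> / B"] conjI allI impI)
    fix z n
    assume z: "solution F z \<and> dist (z 0) p < \<epsilon> / B"
    have "dist (z n) p \<le> r n * dist (z 0) p" using bound z by blast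
    also have "\<dots> \<le> B * dist (z 0) p"
      using B[of n] by (intro mult_right_mono) auto
    also have "\<dots> < \<epsilon>" using z \<open>0 < B\<close> by (simp add: field_simps)
    finally show "dist (z n) p < \<epsilon>" .
  qed (use that \<open>0 < B\<close> in simp)
  moreover have "z \<longlonglongrightarrow> p" if "solution F z" for z
  proof (rule metric_tendsto_imp_tendsto)
    show "(\<lambda>n. r n * dist (z 0) p) \<longlonglongrightarrow> 0"
      using tendsto_mult_left_zero[OF lim] .
    show "\<forall>\<^sub>F n in sequentially. dist (z n) p \<le> dist (r n * dist (z 0) p) 0"
      using bound[OF that] by (auto intro!: always_eventually order_trans[OF _ abs_ge_self])
  qed
  ultimately show ?thesis
    unfolding globally_asymptotically_stable_def lyapunov_stable_def by blast
qed

lemma solution_in_state_space: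
  assumes "solution (step_map \<alpha>\<^sub>1 A\<^sub>1 \<alpha>\<^sub>2) z" "\<alpha>\<^sub>1 > 0" "A\<^sub>1 > 0" "\<alpha>\<^sub>2 > 0"
  shows "z n \<in> state_space"
proof (induction n)
  case 0
  then show ?case using assms by (simp add: solution_def)
next
  case (Suc n)
  have "z (Suc n) = step_map \<alpha>\<^sub>1 A\<^sub>1 \<alpha>\<^sub>2 (z n)" using assms by (simp add: solution_def)
  with Suc assms show ?case
    by (auto simp: step_map_def state_space_def split: prod.splits)
qed

lemma nonneg_equilibrium_step_map_iff:
  fixes \<alpha>\<^sub>1 A\<^sub>1 \<alpha>\<^sub>2 :: real
  assumes "\<alpha>\<^sub>1 > 0" "A\<^sub>1 > 0" "\<alpha>\<^sub>2 > 0"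
  shows "nonneg_equilibrium (step_map \<alpha>\<^sub>1 A\<^sub>1 \<alpha>\<^sub>2) (u, v) \<longleftrightarrow>
    0 \<le> u \<and> v = \<alpha>\<^sub>2 + u \<and> u * (A\<^sub>1 + v) = \<alpha>\<^sub>1"
  using assms
  by (auto simp: nonneg_equilibrium_def solution_def state_space_def step_map_def
      nonzero_eq_divide_eq)

text \<open>Completing the square: \<open>(B + 2 * u)\<^sup>2\<close> equals
  \<open>B\<^sup>2 + 4 * (u * (B + u))\<close>, and the sign condition on \<open>u\<close> selects
  the positive square root.\<close>

lemma quadratic_nonneg_root_iff:
  fixes u B \<alpha> :: real
  assumes "\<alpha> > 0" "B > 0"
  shows "0 \<le> u \<and> u * (B + u) = \<alpha> \<longleftrightarrow> u = (- B + sqrt (B\<^sup>2 + 4 * \<alpha>)) / 2"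
proof -
  have "0 \<le> u \<and> u * (B + u) = \<alpha> \<longleftrightarrow> B \<le> B + 2 * u \<and> (B + 2 * u)\<^sup>2 = B\<^sup>2 + 4 * \<alpha>"
    by (auto simp: power2_eq_square algebra_simps)
  also have "\<dots> \<longleftrightarrow> sqrt (B\<^sup>2 + 4 * \<alpha>) = B + 2 * u"
  proof
    assume *: "sqrt (B\<^sup>2 + 4 * \<alpha>) = B + 2 * u"
    have "B \<le> sqrt (B\<^sup>2 + 4 * \<alpha>)" using assms by (intro real_le_rsqrt) simp
    moreover have "(sqrt (B\<^sup>2 + 4 * \<alpha>))\<^sup>2 = B\<^sup>2 + 4 * \<alpha>"
      using assms by (intro real_sqrt_pow2) auto
    ultimately show "B \<le> B + 2 * u \<and> (B + 2 * u)\<^sup>2 = B\<^sup>2 + 4 * \<alpha>" using * by metis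
  qed (use assms in \<open>auto intro!: real_sqrt_unique\<close>)
  also have "\<dots> \<longleftrightarrow> u = (- B + sqrt (B\<^sup>2 + 4 * \<alpha>)) / 2" by (auto simp: field_simps)
  finally show ?thesis .
qed

lemma step_map_equilibrium_globally_asymptotically_stable:
  fixes \<alpha>\<^sub>1 A\<^sub>1 \<alpha>\<^sub>2 :: real
  assumes pos: "\<alpha>\<^sub>1 > 0" "A\<^sub>1 > 0" "\<alpha>\<^sub>2 > 0"
    and equil: "nonneg_equilibrium (step_map \<alpha>\<^sub>1 A\<^sub>1 \<alpha>\<^sub>2) (u, v)"
  shows "globally_asymptotically_stable (step_map \<alpha>\<^sub>1 A\<^sub>1 \<alpha>\<^sub>2) (u, v)"
proof (rule globally_asymptotically_stable_if_uniform_decay)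
  have "0 \<le> u" and v: "v = \<alpha>\<^sub>2 + u" and uv: "u * (A\<^sub>1 + v) = \<alpha>\<^sub>1"
    using equil unfolding nonneg_equilibrium_step_map_iff[OF pos] by blast+
  define c where "c = u\<^sup>2 / \<alpha>\<^sub>1"
  \<comment> \<open>One-step growth of \<open>e n + d n\<close>: the 1 accounts for
    \<open>d (Suc n) = e n\<close>, and \<open>u / A\<^sub>1\<close> bounds the factor in
    \<open>e (Suc n)\<close> because \<open>y n\<close> is nonnegative.\<close>
  define L where "L = 1 + u / A\<^sub>1"
  have "0 < u" using \<open>0 \<le> u\<close> uv pos by (cases "u = 0") auto
  have "0 \<le> c" using pos by (simp add: c_def)
  have "u\<^sup>2 < \<alpha>\<^sub>1"
  proof -
    have "u * u < u * (A\<^sub>1 + v)" using \<open>0 < u\<close> v pos by (intro mult_strict_left_mono) auto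
    then show ?thesis by (simp add: uv power2_eq_square)
  qed
  then have "c < 1" using pos by (simp add: c_def)
  have "1 \<le> L" using \<open>0 \<le> u\<close> pos by (simp add: L_def)
  show "(\<lambda>n. c ^ (n div 4) * (2 * L ^ 4)) \<longlonglongrightarrow> 0"
    using \<open>0 \<le> c\<close> \<open>c < 1\<close> by (intro tendsto_mult_left_zero power_div_tendsto_zero) auto
  fix z n
  assume sol: "solution (step_map \<alpha>\<^sub>1 A\<^sub>1 \<alpha>\<^sub>2) z"
  define x where "x n = fst (z n)" for n
  define y where "y n = snd (z n)" for n
  define e where "e n = \<bar>x n - u\<bar>" for n
  define d where "d n = \<bar>y n - v\<bar>" for n
  have z: "z n = (x n, y n)" for n by (simp add: x_def y_def)
  have "z n \<in> state_space" for n using solution_in_state_space[OF sol pos] .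
  then have y0: "0 \<le> y n" for n by (simp add: z state_space_def)
  have "z (Suc n) = step_map \<alpha>\<^sub>1 A\<^sub>1 \<alpha>\<^sub>2 (z n)" for n using sol by (simp add: solution_def)
  then have xS: "x (Suc n) = \<alpha>\<^sub>1 / (A\<^sub>1 + y n)" and yS: "y (Suc n) = \<alpha>\<^sub>2 + x n" for n
    by (simp_all add: z step_map_def)
  have Ay: "0 < A\<^sub>1 + y n" for n using y0[of n] pos by linarith
  have dS: "d (Suc n) = e n" for n by (simp add: d_def e_def yS v)
  have eS: "e (Suc n) = u / (A\<^sub>1 + y n) * d n" for n
  proof -
    \<comment> \<open>Substituting \<open>u * (A\<^sub>1 + v)\<close> for
      \<open>\<alpha>\<^sub>1\<close> makes the difference of fractions factor.\<close>
    have "x (Suc n) - u = u / (A\<^sub>1 + y n) * (v - y n)"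
      using Ay[of n] by (simp add: xS uv[symmetric] field_simps)
    then show ?thesis
      using Ay[of n] \<open>0 \<le> u\<close> by (simp add: e_def d_def abs_mult abs_minus_commute)
  qed
  have e_le: "e (Suc n) \<le> u / A\<^sub>1 * d n" for n
    unfolding eS using y0[of n] \<open>0 \<le> u\<close> pos
    by (intro mult_right_mono divide_left_mono) (auto simp: d_def intro: mult_pos_pos add_pos_nonneg)
  have d4: "d (n + 4) \<le> c * d n" for n
  proof -
    \<comment> \<open>Two steps give \<open>y (n + 2) = \<alpha>\<^sub>2 + \<alpha>\<^sub>1 /
      (A\<^sub>1 + y n)\<close>, whose denominator cancels in the product.\<close>
    have "(A\<^sub>1 + y n) * (A\<^sub>1 + y (n + 2)) = (A\<^sub>1 + \<alpha>\<^sub>2) * (A\<^sub>1 + y n) + \<alpha>\<^sub>1"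
      using Ay[of n] by (simp add: numeral_2_eq_2 yS xS field_simps)
    then have ge: "\<alpha>\<^sub>1 \<le> (A\<^sub>1 + y n) * (A\<^sub>1 + y (n + 2))"
      using Ay[of n] pos by simp
    have "d (n + 4) = u\<^sup>2 / ((A\<^sub>1 + y n) * (A\<^sub>1 + y (n + 2))) * d n"
      by (simp add: eval_nat_numeral dS eS mult_ac)
    also have "\<dots> \<le> c * d n"
      unfolding c_def using ge pos Ay
      by (intro mult_right_mono divide_left_mono) (auto simp: d_def intro: mult_pos_pos)
    finally show ?thesis .
  qed
  \<comment> \<open>The errors \<open>e\<close> are the errors \<open>d\<close> shifted by one
    index, so they inherit the contraction.\<close>
  have e4: "e (n + 4) \<le> c * e n" for n using d4[of "Suc n"] unfolding add_Suc dS .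
  have bound: "e n + d n \<le> c ^ (n div 4) * (L ^ 4 * (e 0 + d 0))"
  proof (rule eventual_contraction_bound)
    fix n
    \<comment> \<open>Beyond \<open>e n + u / A\<^sub>1 * d n\<close>, the product
      \<open>L * (e n + d n)\<close> has only the terms \<open>d n\<close> and
      \<open>u / A\<^sub>1 * e n\<close>, both nonnegative.\<close>
    have "0 \<le> u / A\<^sub>1 * e n" using \<open>0 \<le> u\<close> pos by (simp add: e_def)
    then show "e (Suc n) + d (Suc n) \<le> L * (e n + d n)"
      using e_le[of n] by (simp add: dS L_def algebra_simps) (simp add: d_def)
    show "e (n + 4) + d (n + 4) \<le> c * (e n + d n)"
      using e4[of n] d4[of n] by (simp add: distrib_left)
  qed (use \<open>1 \<le> L\<close> \<open>0 \<le> c\<close> in \<open>auto simp: e_def d_def\<close>)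
  have "dist (z n) (u, v) \<le> e n + d n"
    unfolding z dist_Pair_Pair e_def d_def dist_real_def by (rule sqrt_sum_squares_le_sum) auto
  also note bound
  \<comment> \<open>Each coordinate error is at most the Euclidean distance; this is the source of
    the 2 in the rate.\<close>
  also have "e 0 + d 0 \<le> 2 * dist (z 0) (u, v)"
    using dist_fst_le[of "z 0" "(u, v)"] dist_snd_le[of "z 0" "(u, v)"]
    by (simp add: e_def d_def x_def y_def dist_real_def)
  finally show "dist (z n) (u, v) \<le> c ^ (n div 4) * (2 * L ^ 4) * dist (z 0) (u, v)"
    using \<open>0 \<le> c\<close> \<open>1 \<le> L\<close> by (simp add: mult_left_mono mult.assoc mult.left_commute)
qed

theorem theorem14:
  fixes \<alpha>\<^sub>1 A\<^sub>1 \<alpha>\<^sub>2 :: real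
  assumes "\<alpha>\<^sub>1 > 0" and "A\<^sub>1 > 0" and "\<alpha>\<^sub>2 > 0"
  shows "let F = step_map \<alpha>\<^sub>1 A\<^sub>1 \<alpha>\<^sub>2;
             E = ((- \<alpha>\<^sub>2 - A\<^sub>1 + sqrt ((\<alpha>\<^sub>2 + A\<^sub>1)\<^sup>2 + 4 * \<alpha>\<^sub>1)) / 2,
                  (\<alpha>\<^sub>2 - A\<^sub>1 + sqrt ((\<alpha>\<^sub>2 + A\<^sub>1)\<^sup>2 + 4 * \<alpha>\<^sub>1)) / 2)
         in (\<forall>p. nonneg_equilibrium F p \<longleftrightarrow> p = E) \<and> globally_asymptotically_stable F E"
proof -
  define F where "F = step_map \<alpha>\<^sub>1 A\<^sub>1 \<alpha>\<^sub>2"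
  define s where "s = sqrt ((\<alpha>\<^sub>2 + A\<^sub>1)\<^sup>2 + 4 * \<alpha>\<^sub>1)"
  define E where "E = ((- \<alpha>\<^sub>2 - A\<^sub>1 + s) / 2, (\<alpha>\<^sub>2 - A\<^sub>1 + s) / 2)"
  have iff: "nonneg_equilibrium F p \<longleftrightarrow> p = E" for p
  proof (cases p)
    case (Pair u v)
    \<comment> \<open>Eliminating \<open>v\<close> leaves a quadratic in \<open>u\<close> alone,
      with \<open>\<alpha>\<^sub>2 + A\<^sub>1\<close> in the role of \<open>B\<close>.\<close>
    have "nonneg_equilibrium F p \<longleftrightarrow>
        v = \<alpha>\<^sub>2 + u \<and> 0 \<le> u \<and> u * ((\<alpha>\<^sub>2 + A\<^sub>1) + u) = \<alpha>\<^sub>1"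
      unfolding F_def Pair nonneg_equilibrium_step_map_iff[OF assms] by (auto simp: add_ac)
    also have "\<dots> \<longleftrightarrow> v = \<alpha>\<^sub>2 + u \<and> u = (- (\<alpha>\<^sub>2 + A\<^sub>1) + s) / 2"
      unfolding s_def using quadratic_nonneg_root_iff[of \<alpha>\<^sub>1 "\<alpha>\<^sub>2 + A\<^sub>1" u] assms by simp
    also have "\<dots> \<longleftrightarrow> p = E" by (auto simp: Pair E_def field_simps)
    finally show ?thesis .
  qed
  \<comment> \<open>By \<open>iff\<close>, \<open>E\<close> is itself an equilibrium, so the
    stability result applies to it without using its closed form.\<close>
  have "globally_asymptotically_stable F E"
    using step_map_equilibrium_globally_asymptotically_stable[OF assms] iff
    unfolding F_def by (metis prod.collapse)
  with iff show ?thesis unfolding Let_def F_def E_def s_def by blast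
qed

end
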